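(* Let $(S,+)$ be a countable commutative semigroup such that for every $d\in\mathbb{N}$ the set $dS=\{dx:x\in S\}$ is piecewise syndetic in $S$. Let $l\in\mathbb{N}$. Then for any quasi-central set $M\subseteq S$, the set \[ \{(a,b)\in S\times S:\{a,\,a+b,\,a+2b,\ldots,a+lb\}\subseteq M\} \] is quasi-central in $(S\times S,+)$.
   Context: $\mathbb{N}=\{1,2,3,\ldots\}$. For $n\in\mathbb{N}$ and $t\in S$, $nt$ denotes $t+t+\cdots+t$ ($n$ summands). $S\times S$ carries the coordinatewise operation. For a commutative semigroup $(T,+)$, $x\in T$ and $A\subseteq T$, write $-x+A=\{y\in T: x+y\in A\}$. A set $A\subseteq T$ is thick if for every finite $H\subseteq T$ there is $x\in T$ with $H+x\subseteq A$; $A$ is piecewise syndetic if there is a finite $F\subseteq T$ such that $\bigcup_{x\in F}(-x+A)$ is thick. For a countable commutative semigroup $T$, a set $A\subseteq T$ is quasi-central if and only if there is a decreasing sequence $C_1\supseteq C_2\supseteq\cdots$ of subsets of $A$ such that (1) for each $n\in\mathbb{N}$ and each $x\in C_n$ there exists $m\in\mathbb{N}$ with $C_m\subseteq -x+C_n$, and (2) each $C_n$ is piecewise syndetic in $T$. (Equivalently, $A$ belongs to some idempotent ultrafilter in the closure of the smallest ideal of $\beta T$.) The paper calls semigroups satisfying the hypothesis on $dS$ "of class $\mathscr{A}$". *)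

theory Defs
  imports "HOL-Library.Countable_Set" "HOL-Library.Product_Plus"
begin

text \<open>
  A semigroup has no zero in general, so \<open>n\<close>-fold sums are meaningful only for
  \<open>n \<ge> 1\<close>; the value at \<open>n = 0\<close> is junk.
\<close>

definition nsum :: "nat \<Rightarrow> 'a::ab_semigroup_add \<Rightarrow> 'a" where
  "nsum n t = (((+) t) ^^ (n - 1)) t"

lemma nsum_1: "nsum 1 t = t"
  by (simp add: nsum_def)

lemma nsum_Suc: "n \<ge> 1 \<Longrightarrow> nsum (Suc n) t = t + nsum n t"
  by (cases n) (simp_all add: nsum_def)

definition translate_preimage :: "'a::ab_semigroup_add \<Rightarrow> 'a set \<Rightarrow> 'a set" where
  "translate_preimage x A = {y. x + y \<in> A}"

definition thick :: "'a::ab_semigroup_add set \<Rightarrow> bool" where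
  "thick A \<longleftrightarrow> (\<forall>H. finite H \<longrightarrow> (\<exists>x. (\<lambda>h. h + x) ` H \<subseteq> A))"

definition piecewise_syndetic :: "'a::ab_semigroup_add set \<Rightarrow> bool" where
  "piecewise_syndetic A \<longleftrightarrow>
    (\<exists>F. finite F \<and> thick (\<Union>x\<in>F. translate_preimage x A))"

text \<open>
  For countable semigroups this is equivalent to membership in an idempotent ultrafilter lying in
  the closure of the smallest ideal of the Stone-Cech compactification. The sequence is indexed
  from 0 instead of 1.
\<close>

definition quasi_central :: "'a::ab_semigroup_add set \<Rightarrow> bool" where
  "quasi_central A \<longleftrightarrow>
    (\<exists>C :: nat \<Rightarrow> 'a set.
       antimono C \<and> (\<forall>n. C n \<subseteq> A) \<and>
       (\<forall>n. \<forall>x\<in>C n. \<exists>m. C m \<subseteq> translate_preimage x (C n)) \<and>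
       (\<forall>n. piecewise_syndetic (C n)))"

end

theory Submission
  imports Defs
begin

text \<open>
  If the sets \<open>C n\<close> witness that \<open>M\<close> is quasi-central, then the sets of pairs \<open>(a, b)\<close> whose
  progression lies in \<open>C n\<close> satisfy the shift condition, so it suffices to show that progressions
  in a piecewise syndetic set \<open>A\<close> form a piecewise syndetic set of pairs. Finitely many translates
  of \<open>A\<close> cover a thick set \<open>T\<close>; colour \<open>T\<close> by the translate. For all \<open>(y, w)\<close> in a thick subset of
  \<open>S \<times> S\<close>, van der Waerden's theorem applied to \<open>k \<mapsto> y + kw\<close> yields \<open>c\<close>, \<open>d\<close> from a finite range
  and a translate \<open>x\<close> such that \<open>(x + y + cw, dw)\<close> is a progression in \<open>A\<close>. Piecewise syndeticity
  is partition regular, so one triple \<open>(c, d, x)\<close> serves a piecewise syndetic set of \<open>(y, w)\<close>.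
  Its image under \<open>(y, w) \<mapsto> (y + cw, dw)\<close> is piecewise syndetic because the image of the whole
  semigroup is, and this is where the hypothesis on \<open>dS\<close> enters.
\<close>

section \<open>Van der Waerden's theorem\<close>

text \<open>For \<open>l = 0\<close> the bound on \<open>a + l * d\<close> says nothing about
  \<open>d\<close>, so \<open>d \<le> N\<close> is stated separately. It keeps \<open>d\<close> in a
  finite range and leaves room for one step back from the progression once the interval is
  doubled.\<close>

definition forces_progression :: "nat \<Rightarrow> nat \<Rightarrow> nat \<Rightarrow> bool" where
  "forces_progression l r N \<longleftrightarrow>
    (\<forall>\<chi> :: nat \<Rightarrow> nat. (\<forall>k. \<chi> k < r) \<longrightarrow>
      (\<exists>a d. 1 \<le> d \<and> d \<le> N \<and> a + l * d \<le> N \<and> (\<forall>i\<le>l. \<chi> (a + i * d) = \<chi> a)))"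

text \<open>
  Colour focusing, with the common term \<open>f\<close> below the progressions, one for each colour in \<open>K\<close>.
\<close>

definition focused :: "(nat \<Rightarrow> nat) \<Rightarrow> nat \<Rightarrow> nat \<Rightarrow> nat set \<Rightarrow> nat \<Rightarrow> bool" where
  "focused \<chi> l N K f \<longleftrightarrow> f < N \<and>
    (\<forall>c\<in>K. \<exists>d\<ge>1. f + l * d < N \<and> (\<forall>i\<in>{1..l}. \<chi> (f + i * d) = c))"

definition has_progression :: "(nat \<Rightarrow> nat) \<Rightarrow> nat \<Rightarrow> nat \<Rightarrow> bool" where
  "has_progression \<chi> l N \<longleftrightarrow>
    (\<exists>a d. 1 \<le> d \<and> a + l * d < N \<and> (\<forall>i\<le>l. \<chi> (a + i * d) = \<chi> a))"

text \<open>The focus is the term just before each focused progression, so a focus of matching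
  colour prolongs one of them.\<close>

lemma has_progressionI_focused:
  assumes "focused \<chi> l N K f" "\<chi> f \<in> K"
  shows "has_progression \<chi> l N"
proof -
  obtain d where d: "1 \<le> d" "f + l * d < N" "\<forall>i\<in>{1..l}. \<chi> (f + i * d) = \<chi> f"
    using assms unfolding focused_def by blast
  have "\<chi> (f + i * d) = \<chi> f" if "i \<le> l" for i
    using d(3) that by (cases "i = 0") auto
  then show ?thesis
    using d unfolding has_progression_def by blast
qed

lemma has_progression_shift:
  assumes "has_progression (\<lambda>j. \<chi> (m + j)) l n" "m + n \<le> N"
  shows "has_progression \<chi> l N"
proof -
  obtain a d where "1 \<le> d" "a + l * d < n" "\<forall>i\<le>l. \<chi> (m + (a + i * d)) = \<chi> (m + a)"
    using assms(1) unfolding has_progression_def by blast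
  then have "1 \<le> d \<and> (m + a) + l * d < N \<and> (\<forall>i\<le>l. \<chi> ((m + a) + i * d) = \<chi> (m + a))"
    using assms(2) by (simp add: add.assoc)
  then show ?thesis
    unfolding has_progression_def by blast
qed

text \<open>A block of \<open>n\<close> consecutive numbers has one of \<open>r ^ n\<close> colour
  patterns. Colouring blocks by their pattern yields \<open>Suc l\<close> equal blocks in
  progression. Block \<open>B\<close>, one step before them, may be coloured differently; it will
  contain the focus.\<close>

lemma forces_equal_blocks:
  fixes \<chi> :: "nat \<Rightarrow> nat"
  assumes "forces_progression l (r ^ n) N" "\<And>k. \<chi> k < r"
  obtains B D where "1 \<le> D" "B + Suc l * D \<le> 2 * N"
    and "\<And>i j. i \<in> {1..Suc l} \<Longrightarrow> j < n \<Longrightarrow> \<chi> ((B + i * D) * n + j) = \<chi> ((B + D) * n + j)"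
proof -
  define W where "W = {xs :: nat list. set xs \<subseteq> {..<r} \<and> length xs = n}"
  have "finite W" "card W = r ^ n"
    unfolding W_def by (simp_all add: finite_lists_length_eq card_lists_length_eq)
  then obtain e where e: "bij_betw e W {0..<r ^ n}"
    using ex_bij_betw_finite_nat by metis
  \<comment> \<open>Blocks are read from index \<open>N\<close> on: since \<open>D \<le> N\<close>,
    the index \<open>N + a - D\<close> of the preceding block is then a true difference.\<close>
  define w where "w k = map (\<lambda>j. \<chi> ((N + k) * n + j)) [0..<n]" for k
  have w: "w k \<in> W" for k
    using assms(2) by (auto simp: W_def w_def)
  have "e (w k) < r ^ n" for k
    using bij_betwE[OF e] w by auto
  then obtain a D where D: "1 \<le> D" "D \<le> N" "a + l * D \<le> N"
    and eq: "\<forall>i\<le>l. e (w (a + i * D)) = e (w a)"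
    using assms(1)[unfolded forces_progression_def, rule_format, of "\<lambda>k. e (w k)"] by blast
  have eqw: "w (a + i * D) = w a" if "i \<le> l" for i
    using eq that w e by (meson bij_betw_imp_inj_on inj_onD)
  have eq': "\<chi> ((N + (a + i * D)) * n + j) = \<chi> ((N + a) * n + j)" if "i \<le> l" "j < n" for i j
  proof -
    have "w (a + i * D) ! j = w a ! j"
      using eqw that by simp
    then show ?thesis
      using that by (simp add: w_def)
  qed
  show ?thesis
  proof (rule that[of D "N + a - D"])
    show "1 \<le> D" by fact
    show "N + a - D + Suc l * D \<le> 2 * N"
      using D by simp
    fix i j assume i: "i \<in> {1..Suc l}" and j: "j < n"
    then obtain i' where i': "i = Suc i'" "i' \<le> l"
      by (cases i) auto
    have "N + a - D + i * D = N + (a + i' * D)" "N + a - D + D = N + a"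
      using D i' by auto
    then show "\<chi> ((N + a - D + i * D) * n + j) = \<chi> ((N + a - D + D) * n + j)"
      using eq'[OF i'(2) j] by simp
  qed
qed

text \<open>Induction on the number \<open>s\<close> of colours. Progressions found in one block
  recur in all equal blocks; moving by \<open>D\<close> blocks and by a step \<open>e\<close> inside
  the block gives progressions with step \<open>D * n + e\<close>. The recurring focus gives one
  more colour. All are focused at position \<open>f\<close> of block \<open>B\<close>.\<close>

lemma ex_focused:
  assumes "\<And>r. \<exists>N. forces_progression l r N"
  shows "\<exists>N. \<forall>\<chi>. (\<forall>k. \<chi> k < r) \<longrightarrow> has_progression \<chi> (Suc l) N \<or>
    (\<exists>f K. K \<subseteq> {..<r} \<and> card K = s \<and> focused \<chi> (Suc l) N K f)"
proof (induction s)
  case 0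
  show ?case
    by (rule exI[of _ 1]) (auto simp: focused_def intro!: exI[of _ "{}"])
next
  case (Suc s)
  then obtain n where n: "\<And>\<chi>. (\<forall>k. \<chi> k < r) \<Longrightarrow> has_progression \<chi> (Suc l) n \<or>
    (\<exists>f K. K \<subseteq> {..<r} \<and> card K = s \<and> focused \<chi> (Suc l) n K f)"
    by blast
  obtain M where M: "forces_progression l (r ^ n) M"
    using assms by blast
  \<comment> \<open>The block indices involved run from 0 to \<open>2 * M\<close>.\<close>
  define N where "N = (2 * M + 1) * n"
  have "has_progression \<chi> (Suc l) N \<or>
    (\<exists>f K. K \<subseteq> {..<r} \<and> card K = Suc s \<and> focused \<chi> (Suc l) N K f)"
    if \<chi>: "\<forall>k. \<chi> k < r" for \<chi>
  proof -
    obtain B D where D: "1 \<le> D" and BD: "B + Suc l * D \<le> 2 * M"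
      and eq: "\<And>i j. i \<in> {1..Suc l} \<Longrightarrow> j < n \<Longrightarrow> \<chi> ((B + i * D) * n + j) = \<chi> ((B + D) * n + j)"
      using forces_equal_blocks[OF M] \<chi> by metis
    \<comment> \<open>Start of the first of the equal blocks, in which the induction hypothesis is
      applied.\<close>
    define m where "m = (B + D) * n"
    have inside: "(B + i * D) * n + j < N" if "i \<le> Suc l" "j < n" for i j
    proof -
      have "i * D \<le> Suc l * D"
        using that(1) by (rule mult_le_mono1)
      then have "B + i * D \<le> 2 * M"
        using BD by linarith
      then have "(B + i * D) * n \<le> 2 * M * n"
        by (rule mult_le_mono1)
      moreover have "N = 2 * M * n + n"
        by (simp add: N_def)
      ultimately show ?thesis
        using that(2) by linarith
    qed
    have mn: "m + n \<le> N"
    proof -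
      have "B + D \<le> 2 * M"
        using BD by simp
      then have "(B + D) * n \<le> 2 * M * n"
        by (rule mult_le_mono1)
      then show ?thesis
        by (simp add: N_def m_def)
    qed
    consider "has_progression (\<lambda>j. \<chi> (m + j)) (Suc l) n"
      | f K where "K \<subseteq> {..<r}" "card K = s" "focused (\<lambda>j. \<chi> (m + j)) (Suc l) n K f"
      using n[of "\<lambda>j. \<chi> (m + j)"] \<chi> by blast
    then show ?thesis
    proof cases
      case 1
      then show ?thesis
        using has_progression_shift mn by blast
    next
      case (2 f K)
      show ?thesis
      proof (cases "\<chi> (m + f) \<in> K")
        case True
        then show ?thesis
          using has_progressionI_focused[OF 2(3)] has_progression_shift mn by blast
      next
        case False
        have fn: "f < n"
          using 2(3) by (simp add: focused_def)
        have "focused \<chi> (Suc l) N (insert (\<chi> (m + f)) K) (B * n + f)"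
          unfolding focused_def
        proof (intro conjI ballI)
          show "B * n + f < N"
            using inside[of 0 f] fn by simp
          fix c assume "c \<in> insert (\<chi> (m + f)) K"
          \<comment> \<open>For the new colour \<open>e = 0\<close>: the position of the focus is
            kept from block to block. The resulting step \<open>D * n + e\<close> is positive all
            the same.\<close>
          then obtain e where e: "f + Suc l * e < n" "\<forall>i\<in>{1..Suc l}. \<chi> (m + (f + i * e)) = c"
          proof
            assume "c = \<chi> (m + f)"
            then show ?thesis
              using that[of 0] fn by simp
          next
            assume "c \<in> K"
            then show ?thesis
              using that 2(3) unfolding focused_def by blast
          qed
          have split: "B * n + f + i * (D * n + e) = (B + i * D) * n + (f + i * e)" for i
            by (simp add: algebra_simps)
          have small: "f + i * e < n" if "i \<le> Suc l" for i
          proof -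
            have "i * e \<le> Suc l * e"
              using that by (rule mult_le_mono1)
            then show ?thesis
              using e(1) by linarith
          qed
          have "1 \<le> D * n + e"
            using D fn by (cases n; cases D) auto
          moreover have "B * n + f + Suc l * (D * n + e) < N"
            unfolding split using inside small by blast
          moreover have "\<forall>i\<in>{1..Suc l}. \<chi> (B * n + f + i * (D * n + e)) = c"
            unfolding split using eq small e(2) by (auto simp: m_def)
          ultimately show "\<exists>d\<ge>1. B * n + f + Suc l * d < N \<and>
              (\<forall>i\<in>{1..Suc l}. \<chi> (B * n + f + i * d) = c)"
            by blast
        qed
        moreover have "insert (\<chi> (m + f)) K \<subseteq> {..<r}"
          using 2(1) \<chi> by auto
        moreover have "card (insert (\<chi> (m + f)) K) = Suc s"
          using False 2(1,2) finite_subset[OF 2(1)] by simp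
        ultimately show ?thesis
          by blast
      qed
    qed
  qed
  then show ?case
    by blast
qed

text \<open>Once all \<open>r\<close> colours are focused at one point, its own colour is among
  them. The induction on \<open>l\<close> keeps \<open>r\<close> arbitrary because its step passes
  to \<open>r ^ n\<close> colours.\<close>

theorem van_der_Waerden: "\<exists>N. forces_progression l r N"
proof (induction l arbitrary: r)
  case 0
  show ?case
    by (rule exI[of _ 1]) (auto simp: forces_progression_def)
next
  case (Suc l)
  obtain N where N: "\<And>\<chi>. (\<forall>k. \<chi> k < r) \<Longrightarrow> has_progression \<chi> (Suc l) N \<or>
    (\<exists>f K. K \<subseteq> {..<r} \<and> card K = r \<and> focused \<chi> (Suc l) N K f)"
    using ex_focused[OF Suc.IH, of r r] by blast
  have "forces_progression (Suc l) r N"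
    unfolding forces_progression_def
  proof (intro allI impI)
    fix \<chi> :: "nat \<Rightarrow> nat"
    assume \<chi>: "\<forall>k. \<chi> k < r"
    have "has_progression \<chi> (Suc l) N"
    proof (rule ccontr)
      assume no: "\<not> has_progression \<chi> (Suc l) N"
      then obtain f K where K: "K \<subseteq> {..<r}" "card K = r" "focused \<chi> (Suc l) N K f"
        using N[OF \<chi>] by blast
      then have "K = {..<r}"
        by (simp add: card_subset_eq)
      then show False
        using no has_progressionI_focused[OF K(3)] \<chi> by simp
    qed
    then obtain a d where ad: "1 \<le> d" "a + Suc l * d < N" "\<forall>i\<le>Suc l. \<chi> (a + i * d) = \<chi> a"
      unfolding has_progression_def by blast
    moreover have "d \<le> N" "a + Suc l * d \<le> N"
      using ad(2) by simp_all
    ultimately show "\<exists>a d. 1 \<le> d \<and> d \<le> N \<and> a + Suc l * d \<le> N \<and>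
        (\<forall>i\<le>Suc l. \<chi> (a + i * d) = \<chi> a)"
      by blast
  qed
  then show ?case
    by blast
qed

section \<open>Piecewise syndetic sets\<close>

lemma thickE:
  assumes "thick A" "finite H"
  obtains x where "\<And>h. h \<in> H \<Longrightarrow> h + x \<in> A"
proof -
  obtain x where "(\<lambda>h. h + x) ` H \<subseteq> A"
    using assms unfolding thick_def by blast
  then show thesis
    by (intro that[of x]) blast
qed

lemma piecewise_syndetic_iff:
  "piecewise_syndetic A \<longleftrightarrow>
    (\<exists>F. finite F \<and> (\<forall>H. finite H \<longrightarrow> (\<exists>x. \<forall>h\<in>H. \<exists>f\<in>F. f + (h + x) \<in> A)))"
  unfolding piecewise_syndetic_def thick_def translate_preimage_def image_subset_iff by simp

lemma piecewise_syndeticI: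
  assumes "finite F" "\<And>H. finite H \<Longrightarrow> \<exists>x. \<forall>h\<in>H. \<exists>f\<in>F. f + (h + x) \<in> A"
  shows "piecewise_syndetic A"
  unfolding piecewise_syndetic_iff using assms by (intro exI[of _ F] conjI allI impI)

lemma piecewise_syndeticE:
  assumes "piecewise_syndetic A"
  obtains F where "finite F" "\<forall>H. finite H \<longrightarrow> (\<exists>x. \<forall>h\<in>H. \<exists>f\<in>F. f + (h + x) \<in> A)"
  using assms unfolding piecewise_syndetic_iff by (elim exE conjE)

lemma piecewise_syndetic_mono:
  fixes A :: "'a::ab_semigroup_add set"
  assumes "piecewise_syndetic A" "A \<subseteq> B"
  shows "piecewise_syndetic B"
proof -
  obtain F where F: "finite F" "\<forall>H. finite H \<longrightarrow> (\<exists>x. \<forall>h\<in>H. \<exists>f\<in>F. f + (h + x) \<in> A)"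
    using assms(1) by (rule piecewise_syndeticE)
  show ?thesis
  proof (rule piecewise_syndeticI[OF F(1)])
    fix H :: "'a set"
    assume "finite H"
    then obtain x where "\<forall>h\<in>H. \<exists>f\<in>F. f + (h + x) \<in> A"
      using F(2) by blast
    then show "\<exists>x. \<forall>h\<in>H. \<exists>f\<in>F. f + (h + x) \<in> B"
      using assms(2) by (intro exI[of _ x]) blast
  qed
qed

text \<open>Without a zero, any fixed element \<open>?z\<close> serves as the only translate:
  thickness is applied to \<open>?z + H\<close> in place of \<open>H\<close>.\<close>

lemma thick_imp_piecewise_syndetic:
  fixes A :: "'a::ab_semigroup_add set"
  assumes "thick A"
  shows "piecewise_syndetic A"
  unfolding piecewise_syndetic_iff
proof (intro exI[of _ "{undefined}"] conjI allI impI)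
  let ?z = "undefined :: 'a"
  show "finite {?z}"
    by simp
  fix H :: "'a set"
  assume "finite H"
  then obtain x where "\<And>h. h \<in> (+) ?z ` H \<Longrightarrow> h + x \<in> A"
    using thickE[OF assms] by blast
  then have "\<forall>h\<in>H. \<exists>f\<in>{?z}. f + (h + x) \<in> A"
    by (simp add: add.assoc[symmetric])
  then show "\<exists>x. \<forall>h\<in>H. \<exists>f\<in>{?z}. f + (h + x) \<in> A"
    by blast
qed

text \<open>Translating by \<open>g\<close> and then by \<open>f\<close> is translating by
  \<open>f + g\<close>, so these sums form a finite witness for \<open>A\<close>.\<close>

lemma piecewise_syndetic_translates:
  assumes "finite F" "piecewise_syndetic (\<Union>x\<in>F. translate_preimage x A)"
  shows "piecewise_syndetic A"
proof -
  obtain G where G: "finite G"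
    "\<forall>H. finite H \<longrightarrow> (\<exists>x. \<forall>h\<in>H. \<exists>g\<in>G. g + (h + x) \<in> (\<Union>x\<in>F. translate_preimage x A))"
    using assms(2) by (rule piecewise_syndeticE)
  define K where "K = (\<lambda>(f, g). f + g) ` (F \<times> G)"
  have "\<exists>x. \<forall>h\<in>H. \<exists>k\<in>K. k + (h + x) \<in> A" if H: "finite H" for H
  proof -
    obtain x where x: "\<forall>h\<in>H. \<exists>g\<in>G. g + (h + x) \<in> (\<Union>x\<in>F. translate_preimage x A)"
      using G(2)[rule_format, OF H] by blast
    have "\<exists>k\<in>K. k + (h + x) \<in> A" if h: "h \<in> H" for h
    proof -
      obtain g f where "g \<in> G" "f \<in> F" "f + (g + (h + x)) \<in> A"
        using x h by (auto simp: translate_preimage_def)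
      then show ?thesis
        unfolding K_def by (intro bexI[of _ "f + g"]) (auto simp: add.assoc)
    qed
    then show ?thesis
      by blast
  qed
  moreover have "finite K"
    using assms(1) G(1) by (simp add: K_def)
  ultimately show ?thesis
    by (rule piecewise_syndeticI[rotated])
qed

text \<open>If \<open>B\<close> is not thick, some finite \<open>F\<close> has no translate inside
  \<open>B\<close>. A translate of \<open>F + H\<close> inside \<open>A \<union> B\<close> contains
  a translate of \<open>F\<close> for each \<open>h\<close>, which must meet
  \<open>A\<close>.\<close>

lemma thick_Un:
  assumes "thick (A \<union> B)"
  shows "piecewise_syndetic A \<or> thick B"
proof (rule disjCI)
  assume "\<not> thick B"
  then obtain F where F: "finite F" "\<And>x. \<exists>f\<in>F. f + x \<notin> B"
    unfolding thick_def image_subset_iff by blast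
  have "\<exists>x. \<forall>h\<in>H. \<exists>f\<in>F. f + (h + x) \<in> A" if H: "finite H" for H
  proof -
    have "finite ((\<lambda>(f, h). f + h) ` (F \<times> H))"
      using F(1) H by simp
    then obtain x where x: "\<And>y. y \<in> (\<lambda>(f, h). f + h) ` (F \<times> H) \<Longrightarrow> y + x \<in> A \<union> B"
      using thickE[OF assms] by blast
    have "\<exists>f\<in>F. f + (h + x) \<in> A" if h: "h \<in> H" for h
    proof -
      obtain f where f: "f \<in> F" "f + (h + x) \<notin> B"
        using F(2) by blast
      then have "f + h + x \<in> A \<union> B"
        using h by (intro x image_eqI[of _ _ "(f, h)"]) auto
      then show ?thesis
        using f by (auto simp: add.assoc)
    qed
    then show ?thesis
      by blast
  qed
  then show "piecewise_syndetic A"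
    by (rule piecewise_syndeticI[OF F(1)])
qed

text \<open>Partition regularity. The thick union of translates splits into the translates of
  \<open>A\<close> and those of \<open>B\<close>; one part is piecewise syndetic, and this descends
  from finitely many translates to the set itself.\<close>

lemma piecewise_syndetic_Un:
  assumes "piecewise_syndetic (A \<union> B)"
  shows "piecewise_syndetic A \<or> piecewise_syndetic B"
proof -
  obtain F where F: "finite F" "thick (\<Union>x\<in>F. translate_preimage x (A \<union> B))"
    using assms unfolding piecewise_syndetic_def by blast
  have "(\<Union>x\<in>F. translate_preimage x (A \<union> B)) =
      (\<Union>x\<in>F. translate_preimage x A) \<union> (\<Union>x\<in>F. translate_preimage x B)"
    by (auto simp: translate_preimage_def)
  then have "piecewise_syndetic (\<Union>x\<in>F. translate_preimage x A) \<or>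
      piecewise_syndetic (\<Union>x\<in>F. translate_preimage x B)"
    using F(2) thick_Un thick_imp_piecewise_syndetic by fastforce
  then show ?thesis
    using piecewise_syndetic_translates[OF F(1)] by blast
qed

lemma not_piecewise_syndetic_empty: "\<not> piecewise_syndetic ({} :: 'a::ab_semigroup_add set)"
proof
  assume "piecewise_syndetic ({} :: 'a set)"
  then obtain F :: "'a set" where
    "\<forall>H. finite H \<longrightarrow> (\<exists>x. \<forall>h\<in>H. \<exists>f\<in>F. f + (h + x) \<in> {})"
    by (rule piecewise_syndeticE)
  from this[rule_format, of "{undefined}"] show False
    by simp
qed

lemma piecewise_syndetic_UN:
  assumes "finite J" "piecewise_syndetic (\<Union>j\<in>J. P j)"
  shows "\<exists>j\<in>J. piecewise_syndetic (P j)"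
  using assms
proof (induction J)
  case empty
  then show ?case
    by (simp add: not_piecewise_syndetic_empty)
next
  case (insert j J)
  then show ?case
    using piecewise_syndetic_Un[of "P j" "\<Union>j\<in>J. P j"] by auto
qed

text \<open>The assumption on the range lifts a finite \<open>H\<close>, up to translation, to
  finitely many preimages; the assumption on \<open>P\<close> translates these into
  \<open>P\<close>. Applying \<open>\<psi>\<close> combines both translations into
  \<open>\<psi> f + g\<close>.\<close>

lemma piecewise_syndetic_image_hom:
  assumes hom: "\<And>x y. \<psi> (x + y) = \<psi> x + \<psi> y"
    and range: "piecewise_syndetic (range \<psi>)" and P: "piecewise_syndetic P"
  shows "piecewise_syndetic (\<psi> ` P)"
proof -
  obtain F where F: "finite F" "\<forall>H. finite H \<longrightarrow> (\<exists>x. \<forall>h\<in>H. \<exists>f\<in>F. f + (h + x) \<in> P)"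
    using P by (rule piecewise_syndeticE)
  obtain G where G: "finite G" "\<forall>H. finite H \<longrightarrow> (\<exists>x. \<forall>h\<in>H. \<exists>g\<in>G. g + (h + x) \<in> range \<psi>)"
    using range by (rule piecewise_syndeticE)
  define K where "K = (\<lambda>(f, g). \<psi> f + g) ` (F \<times> G)"
  have "\<exists>x. \<forall>h\<in>H. \<exists>k\<in>K. k + (h + x) \<in> \<psi> ` P" if H: "finite H" for H
  proof -
    obtain x where "\<forall>h\<in>H. \<exists>g\<in>G. g + (h + x) \<in> range \<psi>"
      using G(2)[rule_format, OF H] by blast
    then have "\<forall>h\<in>H. \<exists>t. \<exists>g\<in>G. \<psi> t = g + (h + x)"
      by (metis rangeE)
    then obtain t where t: "\<And>h. h \<in> H \<Longrightarrow> \<exists>g\<in>G. \<psi> (t h) = g + (h + x)"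
      by metis
    obtain y where y: "\<forall>s\<in>t ` H. \<exists>f\<in>F. f + (s + y) \<in> P"
      using F(2)[rule_format, OF finite_imageI[OF H]] by blast
    have "\<exists>k\<in>K. k + (h + (x + \<psi> y)) \<in> \<psi> ` P" if h: "h \<in> H" for h
    proof -
      obtain g f where g: "g \<in> G" "\<psi> (t h) = g + (h + x)" and f: "f \<in> F" "f + (t h + y) \<in> P"
        using t y h by blast
      have "\<psi> f + g + (h + (x + \<psi> y)) = \<psi> (f + (t h + y))"
        by (simp add: hom g(2) add.assoc)
      then show ?thesis
        using f g(1) unfolding K_def by (intro bexI[of _ "\<psi> f + g"]) auto
    qed
    then show ?thesis
      by blast
  qed
  moreover have "finite K"
    using F(1) G(1) by (simp add: K_def)
  ultimately show ?thesis
    by (rule piecewise_syndeticI[rotated])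
qed

text \<open>
  Translation in one coordinate of a product is such a \<open>\<sigma>\<close>, but in the absence of a zero it is not
  addition of an element.
\<close>

lemma piecewise_syndetic_image_multiplier:
  assumes \<sigma>: "\<And>x y. \<sigma> (x + y) = \<sigma> x + y" and "piecewise_syndetic P"
  shows "piecewise_syndetic (\<sigma> ` P)"
proof -
  obtain F where F: "finite F" "\<forall>H. finite H \<longrightarrow> (\<exists>x. \<forall>h\<in>H. \<exists>f\<in>F. f + (h + x) \<in> P)"
    using assms(2) by (rule piecewise_syndeticE)
  have "\<exists>x. \<forall>h\<in>H. \<exists>k\<in>\<sigma> ` F. k + (h + x) \<in> \<sigma> ` P" if H: "finite H" for H
  proof -
    obtain x where x: "\<forall>h\<in>H. \<exists>f\<in>F. f + (h + x) \<in> P"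
      using F(2)[rule_format, OF H] by blast
    then have "\<forall>h\<in>H. \<exists>k\<in>\<sigma> ` F. k + (h + x) \<in> \<sigma> ` P"
      by (force simp: \<sigma>[symmetric])
    then show ?thesis
      by blast
  qed
  moreover have "finite (\<sigma> ` F)"
    using F(1) by simp
  ultimately show ?thesis
    by (rule piecewise_syndeticI[rotated])
qed

section \<open>Progressions in commutative semigroups\<close>

lemma nsum_plus: "m \<ge> 1 \<Longrightarrow> n \<ge> 1 \<Longrightarrow> nsum (m + n) t = nsum m t + nsum n t"
  by (induction m rule: nat_induct_at_least) (simp_all add: nsum_1[simplified] nsum_Suc add.assoc)

lemma nsum_mult: "m \<ge> 1 \<Longrightarrow> n \<ge> 1 \<Longrightarrow> nsum (m * n) t = nsum m (nsum n t)"
  by (induction m rule: nat_induct_at_least)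
    (simp_all add: nsum_1[simplified] nsum_Suc nsum_plus)

lemma nsum_add: "m \<ge> 1 \<Longrightarrow> nsum m (s + t) = nsum m s + nsum m t"
  by (induction m rule: nat_induct_at_least) (simp_all add: nsum_1[simplified] nsum_Suc ac_simps)

text \<open>The first term is listed apart because \<open>nsum 0 b\<close> is \<open>b\<close> and
  not a zero.\<close>

definition progressions_in :: "nat \<Rightarrow> 'a::ab_semigroup_add set \<Rightarrow> ('a \<times> 'a) set" where
  "progressions_in l A = {(a, b). a \<in> A \<and> (\<forall>i\<in>{1..l}. a + nsum i b \<in> A)}"

text \<open>A substitute for subtraction: one \<open>u\<close> from which every \<open>w\<close> in
  a finite set can be split off. It is built by adding the elements up.\<close>

lemma ex_common_multiple:
  fixes W :: "'a::ab_semigroup_add set"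
  assumes "finite W"
  shows "\<exists>u. \<forall>w\<in>W. \<exists>z. u = z + w"
  using assms
proof (induction W)
  case (insert w W)
  then obtain u where "\<forall>w\<in>W. \<exists>z. u = z + w"
    by blast
  then have "\<forall>v\<in>insert w W. \<exists>z. u + w = z + v"
    by (metis add.assoc add.commute insertE)
  then show ?case
    by blast
qed simp

text \<open>The hypothesis solves the second coordinate for \<open>w\<close>. To solve the first for
  \<open>y\<close>, the term \<open>nsum c w\<close> must split off from the translation, for all
  \<open>w\<close> that occur; hence \<open>u\<close> is a common multiple of these terms.\<close>

lemma piecewise_syndetic_range_progression:
  assumes d: "piecewise_syndetic (range (nsum d :: 'a::ab_semigroup_add \<Rightarrow> 'a))"
  shows "piecewise_syndetic (range (\<lambda>(y :: 'a, w). (y + nsum c w, nsum d w)))"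
proof -
  obtain F :: "'a set" where F: "finite F"
    "\<forall>H. finite H \<longrightarrow> (\<exists>x. \<forall>h\<in>H. \<exists>f\<in>F. f + (h + x) \<in> range (nsum d))"
    using d by (rule piecewise_syndeticE)
  \<comment> \<open>There need be no zero, so an arbitrary element is the first coordinate of the
    finitely many translates.\<close>
  fix z :: 'a
  have "\<exists>x. \<forall>h\<in>H. \<exists>k\<in>{z} \<times> F. k + (h + x) \<in> range (\<lambda>(y, w). (y + nsum c w, nsum d w))"
    if H: "finite H" for H :: "('a \<times> 'a) set"
  proof -
    obtain v where "\<forall>h\<in>snd ` H. \<exists>f\<in>F. f + (h + v) \<in> range (nsum d)"
      using F(2)[rule_format, OF finite_imageI[OF H]] by blast
    then have "\<forall>h\<in>H. \<exists>w. \<exists>f\<in>F. f + (snd h + v) = nsum d w"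
      by (metis imageI rangeE)
    then obtain w where w: "\<And>h. h \<in> H \<Longrightarrow> \<exists>f\<in>F. f + (snd h + v) = nsum d (w h)"
      by metis
    obtain u where u: "\<forall>s\<in>(\<lambda>h. nsum c (w h)) ` H. \<exists>z. u = z + s"
      using ex_common_multiple H by blast
    have "\<exists>k\<in>{z} \<times> F. k + (h + (u, v)) \<in> range (\<lambda>(y, w). (y + nsum c w, nsum d w))"
      if h: "h \<in> H" for h
    proof -
      obtain f t where f: "f \<in> F" "f + (snd h + v) = nsum d (w h)" and t: "u = t + nsum c (w h)"
        using w u h by blast
      have "(z, f) + (h + (u, v)) = (\<lambda>(y, w). (y + nsum c w, nsum d w)) (z + fst h + t, w h)"
        using f(2) t by (cases h) (simp add: add.assoc)
      then show ?thesis
        using f(1) by (metis (no_types, lifting) SigmaI insertI1 rangeI)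
    qed
    then show ?thesis
      by blast
  qed
  moreover have "finite ({z} \<times> F)"
    using F(1) by simp
  ultimately show ?thesis
    by (rule piecewise_syndeticI[rotated])
qed

text \<open>The translation \<open>v\<close> of the differences can be any element. Once it is
  fixed, the terms to be moved into \<open>T\<close> form a finite set, and thickness supplies
  \<open>u\<close>.\<close>

lemma thick_progressions:
  fixes T :: "'a::ab_semigroup_add set"
  assumes "thick T" "finite I"
  shows "thick {(y, w). \<forall>k\<in>I. y + nsum k w \<in> T}"
  unfolding thick_def
proof (intro allI impI)
  fix H :: "('a \<times> 'a) set" and v :: 'a
  assume "finite H"
  then have "finite ((\<lambda>(h, k). fst h + nsum k (snd h + v)) ` (H \<times> I))"
    using assms(2) by simp
  then obtain u where
    u: "\<And>p. p \<in> (\<lambda>(h, k). fst h + nsum k (snd h + v)) ` (H \<times> I) \<Longrightarrow> p + u \<in> T"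
    using thickE[OF assms(1)] by blast
  have "fst h + u + nsum k (snd h + v) \<in> T" if "h \<in> H" "k \<in> I" for h k
    using u[of "fst h + nsum k (snd h + v)"] that by (force simp: ac_simps)
  then have "(\<lambda>h. h + (u, v)) ` H \<subseteq> {(y, w). \<forall>k\<in>I. y + nsum k w \<in> T}"
    by force
  then show "\<exists>x. (\<lambda>h. h + x) ` H \<subseteq> {(y, w). \<forall>k\<in>I. y + nsum k w \<in> T}"
    by blast
qed

lemma piecewise_syndetic_progressions_in:
  fixes A :: "'a::ab_semigroup_add set"
  assumes dS: "\<And>d. d \<ge> 1 \<Longrightarrow> piecewise_syndetic (range (nsum d :: 'a \<Rightarrow> 'a))"
    and A: "piecewise_syndetic A"
  shows "piecewise_syndetic (progressions_in l A)"
proof -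
  obtain F where F: "finite F" "thick (\<Union>x\<in>F. translate_preimage x A)"
    using A unfolding piecewise_syndetic_def by blast
  define T where "T = (\<Union>x\<in>F. translate_preimage x A)"
  \<comment> \<open>An empty \<open>F\<close> would make the empty set thick. The element is the
    default colour outside \<open>T\<close>.\<close>
  obtain x0 where x0: "x0 \<in> F"
    using F not_piecewise_syndetic_empty thick_imp_piecewise_syndetic by fastforce
  define col where "col z = (if z \<in> T then SOME x. x \<in> F \<and> x + z \<in> A else x0)" for z
  have colT: "col z \<in> F \<and> col z + z \<in> A" if z: "z \<in> T" for z
  proof -
    have "\<exists>x. x \<in> F \<and> x + z \<in> A"
      using z by (auto simp: T_def translate_preimage_def)
    then have "(SOME x. x \<in> F \<and> x + z \<in> A) \<in> F \<and> (SOME x. x \<in> F \<and> x + z \<in> A) + z \<in> A"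
      by (rule someI_ex)
    then show ?thesis
      using z by (simp add: col_def)
  qed
  then have colF: "col z \<in> F" for z
    using x0 by (cases "z \<in> T") (auto simp: col_def)
  obtain e where e: "bij_betw e F {0..<card F}"
    using ex_bij_betw_finite_nat F(1) by blast
  obtain N where N: "forces_progression l (card F) N"
    using van_der_Waerden by blast
  \<comment> \<open>Only positive multiples make sense, so \<open>k\<close> receives the colour of
    \<open>y + nsum (Suc k) w\<close>. A progression of indices starting at \<open>a \<le> N\<close>
    thus gives \<open>c = Suc a\<close>.\<close>
  define J where "J = {1..Suc N} \<times> {1..N} \<times> F"
  define P where "P = (\<lambda>(c, d, x). {(y, w). \<forall>i\<le>l. x + (y + nsum (c + i * d) w) \<in> A})"
  have "{(y, w). \<forall>k\<in>{1..Suc N}. y + nsum k w \<in> T} \<subseteq> (\<Union>j\<in>J. P j)"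
  proof clarify
    fix y w assume yw: "\<forall>k\<in>{1..Suc N}. y + nsum k w \<in> T"
    have "\<forall>k. e (col (y + nsum (Suc k) w)) < card F"
      using bij_betwE[OF e] colF by auto
    then obtain a d where d: "1 \<le> d" "d \<le> N" "a + l * d \<le> N"
      and eq: "\<forall>i\<le>l. e (col (y + nsum (Suc (a + i * d)) w)) = e (col (y + nsum (Suc a) w))"
      using N[unfolded forces_progression_def, rule_format,
        of "\<lambda>k. e (col (y + nsum (Suc k) w))"] by blast
    define x where "x = col (y + nsum (Suc a) w)"
    have "x + (y + nsum (Suc a + i * d) w) \<in> A" if i: "i \<le> l" for i
    proof -
      have "col (y + nsum (Suc (a + i * d)) w) = x"
        unfolding x_def using eq i colF e by (meson bij_betw_imp_inj_on inj_onD)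
      moreover have "a + i * d \<le> N"
        using mult_le_mono1[OF i, of d] d(3) by linarith
      then have "y + nsum (Suc (a + i * d)) w \<in> T"
        using yw by auto
      ultimately show ?thesis
        using colT by force
    qed
    then have "(y, w) \<in> P (Suc a, d, x)"
      by (simp add: P_def)
    moreover have "(Suc a, d, x) \<in> J"
      using d colF by (auto simp: J_def x_def)
    ultimately show "(y, w) \<in> (\<Union>j\<in>J. P j)"
      by blast
  qed
  moreover have "thick {(y, w). \<forall>k\<in>{1..Suc N}. y + nsum k w \<in> T}"
    unfolding T_def using F(2) by (rule thick_progressions) simp
  ultimately have "piecewise_syndetic (\<Union>j\<in>J. P j)"
    using thick_imp_piecewise_syndetic piecewise_syndetic_mono by blast
  moreover have "finite J"
    using F(1) by (simp add: J_def)
  ultimately obtain c d x where J: "(c, d, x) \<in> J" and PS: "piecewise_syndetic (P (c, d, x))"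
    using piecewise_syndetic_UN by (metis prod_cases3)
  have cd: "c \<ge> 1" "d \<ge> 1"
    using J by (auto simp: J_def)
  define \<psi> where "\<psi> = (\<lambda>(y :: 'a, w). (y + nsum c w, nsum d w))"
  \<comment> \<open>The translate \<open>x\<close> must act on the first term alone, leaving the
    common difference unchanged.\<close>
  define \<sigma> where "\<sigma> = (\<lambda>(a :: 'a, b :: 'a). (x + a, b))"
  have "piecewise_syndetic (\<psi> ` P (c, d, x))"
  proof (rule piecewise_syndetic_image_hom)
    show "\<psi> (p + q) = \<psi> p + \<psi> q" for p q
      using cd by (cases p; cases q) (simp add: \<psi>_def nsum_add ac_simps)
    show "piecewise_syndetic (range \<psi>)"
      unfolding \<psi>_def using dS[OF cd(2)] by (rule piecewise_syndetic_range_progression)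
  qed (fact PS)
  then have "piecewise_syndetic (\<sigma> ` \<psi> ` P (c, d, x))"
    by (rule piecewise_syndetic_image_multiplier[rotated]) (auto simp: \<sigma>_def add.assoc)
  moreover have "\<sigma> (\<psi> (y, w)) \<in> progressions_in l A" if yw: "(y, w) \<in> P (c, d, x)" for y w
  proof -
    have "x + (y + nsum c w) + nsum i (nsum d w) \<in> A" if i: "i \<in> {1..l}" for i
    proof -
      have "nsum (c + i * d) w = nsum c w + nsum i (nsum d w)"
        using i cd by (simp add: nsum_plus nsum_mult)
      moreover have "x + (y + nsum (c + i * d) w) \<in> A"
        using yw i by (auto simp: P_def)
      ultimately show ?thesis
        by (simp add: add.assoc)
    qed
    moreover have "x + (y + nsum c w) \<in> A"
      using yw by (force simp: P_def)
    ultimately show ?thesis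
      by (simp add: \<sigma>_def \<psi>_def progressions_in_def)
  qed
  then have "\<sigma> ` \<psi> ` P (c, d, x) \<subseteq> progressions_in l A"
    by (auto simp: image_subset_iff)
  ultimately show ?thesis
    by (rule piecewise_syndetic_mono)
qed

section \<open>Quasi-centrality of the set of progressions\<close>

lemma progressions_in_mono: "A \<subseteq> B \<Longrightarrow> progressions_in l A \<subseteq> progressions_in l B"
  by (auto simp: progressions_in_def)

text \<open>Each of the finitely many terms of \<open>p\<close> has its own index; since
  \<open>C\<close> decreases, the largest index serves all terms. Adding progressions termwise adds
  first terms and common differences.\<close>

lemma progressions_in_shift:
  fixes C :: "nat \<Rightarrow> 'a::ab_semigroup_add set"
  assumes C: "antimono C" "\<And>n x. x \<in> C n \<Longrightarrow> \<exists>m. C m \<subseteq> translate_preimage x (C n)"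
    and p: "p \<in> progressions_in l (C n)"
  shows "\<exists>m. progressions_in l (C m) \<subseteq> translate_preimage p (progressions_in l (C n))"
proof -
  obtain a b where ab: "p = (a, b)" "a \<in> C n" "\<And>i. i \<in> {1..l} \<Longrightarrow> a + nsum i b \<in> C n"
    using p by (auto simp: progressions_in_def)
  define X where "X = insert a ((\<lambda>i. a + nsum i b) ` {1..l})"
  have "\<forall>x\<in>X. \<exists>m. C m \<subseteq> translate_preimage x (C n)"
    using ab C(2) by (auto simp: X_def)
  then obtain m where m: "\<And>x. x \<in> X \<Longrightarrow> C (m x) \<subseteq> translate_preimage x (C n)"
    by metis
  define M where "M = Max (m ` X)"
  have "finite X"
    by (simp add: X_def)
  then have "C M \<subseteq> C (m x)" if "x \<in> X" for x
    using that C(1) by (simp add: M_def antimonoD)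
  then have M: "x + y \<in> C n" if "x \<in> X" "y \<in> C M" for x y
    using m that by (force simp: translate_preimage_def)
  have "progressions_in l (C M) \<subseteq> translate_preimage p (progressions_in l (C n))"
  proof clarify
    fix c d assume cd: "(c, d) \<in> progressions_in l (C M)"
    have "a + c + nsum i (b + d) \<in> C n" if i: "i \<in> {1..l}" for i
    proof -
      have "(a + nsum i b) + (c + nsum i d) \<in> C n"
        using cd i by (intro M) (auto simp: X_def progressions_in_def)
      then show ?thesis
        using i by (simp add: nsum_add ac_simps)
    qed
    moreover have "a + c \<in> C n"
      using cd by (intro M) (auto simp: X_def progressions_in_def)
    ultimately show "(c, d) \<in> translate_preimage p (progressions_in l (C n))"
      by (simp add: translate_preimage_def progressions_in_def ab(1))
  qed
  then show ?thesis
    by blast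
qed

theorem theorem13:
  fixes M :: "'a::ab_semigroup_add set" and l :: nat
  assumes "countable (UNIV :: 'a set)"
    and "\<And>d::nat. d \<ge> 1 \<Longrightarrow> piecewise_syndetic (range (nsum d :: 'a \<Rightarrow> 'a))"
    and "l \<ge> 1"
    and "quasi_central M"
  shows "quasi_central
    {(a, b) :: 'a \<times> 'a | a b. {a} \<union> {a + nsum i b | i. 1 \<le> i \<and> i \<le> l} \<subseteq> M}"
proof -
  obtain C :: "nat \<Rightarrow> 'a set" where C: "antimono C" "\<And>n. C n \<subseteq> M"
    "\<And>n x. x \<in> C n \<Longrightarrow> \<exists>m. C m \<subseteq> translate_preimage x (C n)"
    "\<And>n. piecewise_syndetic (C n)"
    using assms(4) unfolding quasi_central_def by blast
  have "quasi_central (progressions_in l M)"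
    unfolding quasi_central_def
  proof (intro exI[of _ "\<lambda>n. progressions_in l (C n)"] conjI allI ballI)
    show "antimono (\<lambda>n. progressions_in l (C n))"
      using C(1) by (intro antimonoI progressions_in_mono) (rule antimonoD)
    show "progressions_in l (C n) \<subseteq> progressions_in l M" for n
      using C(2) by (rule progressions_in_mono)
    show "\<exists>m. progressions_in l (C m) \<subseteq> translate_preimage p (progressions_in l (C n))"
      if "p \<in> progressions_in l (C n)" for n p
      using C(1,3) that by (rule progressions_in_shift)
    show "piecewise_syndetic (progressions_in l (C n))" for n
      using assms(2) C(4) by (rule piecewise_syndetic_progressions_in)
  qed
  moreover have "progressions_in l M =
      {(a, b) | a b. {a} \<union> {a + nsum i b | i. 1 \<le> i \<and> i \<le> l} \<subseteq> M}"
    unfolding progressions_in_def by (auto, blast)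
  ultimately show ?thesis
    by simp
qed

end
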